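(* Let $\mathcal G$ be a Lie groupoid. Define $J_{\mathrm c}:\mathcal G\to X_{\mathcal G}\times X_{\mathcal G}$ by $J_{\mathrm c}(g)=(t_{\mathcal G}(g),s_{\mathcal G}(g))$, let $$\mathcal G^2\times_{J_{\mathrm c}}\mathcal G=\{(g_1,g_2;g_3)\in\mathcal G^3: s_{\mathcal G}(g_1)=t_{\mathcal G}(g_3),\ s_{\mathcal G}(g_2)=s_{\mathcal G}(g_3)\},$$ and define $\Psi_{\mathrm c}:\mathcal G^2\times_{J_{\mathrm c}}\mathcal G\to\mathcal G$ by $\Psi_{\mathrm c}(g_1,g_2;g_3)=g_1g_3g_2^{-1}$. Then $(\mathcal G,J_{\mathrm c},\Psi_{\mathrm c})$ is a left action of the product groupoid $\mathcal G^2=\mathcal G\times\mathcal G$ on the manifold $\mathcal G$ (the generalized conjugation of $\mathcal G$).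
   Context: Lie groupoids: a groupoid has a set of arrows $\mathcal G$, a set of objects $X_{\mathcal G}$, surjective source and target maps $s_{\mathcal G},t_{\mathcal G}:\mathcal G\to X_{\mathcal G}$, a unit map $\iota_{\mathcal G}:X_{\mathcal G}\to\mathcal G$, an inversion $g\mapsto g^{-1}$, and an associative product $g_1g_2$ defined iff $s_{\mathcal G}(g_1)=t_{\mathcal G}(g_2)$, with $s_{\mathcal G}(g_1g_2)=s_{\mathcal G}(g_2)$, $t_{\mathcal G}(g_1g_2)=t_{\mathcal G}(g_1)$ and the usual unit and inverse laws. It is a Lie groupoid if $X_{\mathcal G}$ is a smooth Hausdorff manifold, $\mathcal G$ is a smooth manifold (possibly non-Hausdorff, not second countable), $s_{\mathcal G}$ is a surjective submersion with Hausdorff fibres, and all other structure maps are smooth. The product groupoid $\mathcal G\times\mathcal G$ has objects $X_{\mathcal G}\times X_{\mathcal G}$ and all structure maps and the product defined componentwise. Left action of a Lie groupoid $\mathcal K$ on a smooth manifold $N$: a triple $(N,J,\Psi)$ with $J:N\to X_{\mathcal K}$ smooth (the momentum) and $\Psi:\mathcal K\times_JN=\{(k,n):s_{\mathcal K}(k)=J(n)\}\to N$ smooth, written $\Psi(k,n)=kn$, such that $J(kn)=t_{\mathcal K}(k)$, $k_1(k_2n)=(k_1k_2)n$ whenever $s_{\mathcal K}(k_1)=t_{\mathcal K}(k_2)$ and $s_{\mathcal K}(k_2)=J(n)$, and $\iota_{\mathcal K}(J(n))n=n$ for all $n\in N$. *)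

theory Defs
  imports "HOL-Analysis.Analysis"
begin

section \<open>Smooth maps between subsets of Euclidean spaces\<close>

text \<open>To be used for open \<open>U\<close> only: all iterated directional derivatives up to order \<open>k\<close> exist
  and are continuous on \<open>U\<close>.\<close>

primrec Ck_on :: "nat \<Rightarrow> 'a::euclidean_space set \<Rightarrow> ('a \<Rightarrow> 'b::euclidean_space) \<Rightarrow> bool" where
  "Ck_on 0 U f \<longleftrightarrow> continuous_on U f"
| "Ck_on (Suc k) U f \<longleftrightarrow>
     (\<forall>x\<in>U. f differentiable (at x)) \<and>
     (\<forall>v. Ck_on k U (\<lambda>x. frechet_derivative f (at x) v))"

text \<open>A map on an arbitrary subset \<open>S\<close> is smooth if near each point of \<open>S\<close> it extends to a
  \<open>C\<^sup>\<infinity>\<close> map on an open subset of the ambient space. For \<open>S\<close> open this is ordinary smoothness;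
  for \<open>S\<close> relatively open in a linear subspace \<open>E\<close> it is ordinary smoothness on an open subset
  of the vector space \<open>E\<close> (extend by composing with the orthogonal projection to \<open>E\<close>).\<close>

definition smooth_on :: "'a::euclidean_space set \<Rightarrow> ('a \<Rightarrow> 'b::euclidean_space) \<Rightarrow> bool" where
  "smooth_on S f \<longleftrightarrow>
     (\<forall>x\<in>S. \<exists>U F. open U \<and> x \<in> U \<and> (\<forall>k. Ck_on k U F) \<and> (\<forall>y\<in>S \<inter> U. F y = f y))"

section \<open>Smooth manifolds\<close>

text \<open>A manifold of dimension \<open>n\<close> is modelled on an \<open>n\<close>-dimensional linear subspace of some
  Euclidean space. A subspace is used, and not a whole type of class \<^class>\<open>euclidean_space\<close>,
  because those types all have positive dimension, whereas dimension \<open>0\<close> has to be allowed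
  (a Lie group is a Lie groupoid over a point). A chart is a pair \<open>(U, \<phi>)\<close>; the values of \<open>\<phi>\<close>
  outside of \<open>U\<close> are irrelevant. The atlas is not required to be maximal.\<close>

record ('p, 'e) manifold =
  mtop :: "'p topology"
  model :: "'e set"
  atlas :: "('p set \<times> ('p \<Rightarrow> 'e)) set"

abbreviation points :: "('p, 'e) manifold \<Rightarrow> 'p set" where
  "points M \<equiv> topspace (mtop M)"

text \<open>Neither the Hausdorff property nor second countability is part of the definition.\<close>

locale smooth_manifold =
  fixes M :: "('p, 'e::euclidean_space) manifold"
  assumes subspace_model: "subspace (model M)"
    and chart_domain: "(U, \<phi>) \<in> atlas M \<Longrightarrow> openin (mtop M) U"
    and chart_image: "(U, \<phi>) \<in> atlas M \<Longrightarrow> openin (top_of_set (model M)) (\<phi> ` U)"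
    and chart_homeo: "(U, \<phi>) \<in> atlas M \<Longrightarrow>
          homeomorphic_map (subtopology (mtop M) U) (top_of_set (\<phi> ` U)) \<phi>"
    and charts_cover: "p \<in> points M \<Longrightarrow> \<exists>(U, \<phi>) \<in> atlas M. p \<in> U"
    and charts_compatible: "(U, \<phi>) \<in> atlas M \<Longrightarrow> (V, \<psi>) \<in> atlas M \<Longrightarrow>
          smooth_on (\<phi> ` (U \<inter> V)) (\<psi> \<circ> inv_into U \<phi>)"

text \<open>Smoothness of a map that is defined on a subset \<open>A\<close> of \<open>M\<close>. For \<open>A = points M\<close> this is
  smoothness of a map between manifolds. It is also applied to fibre products along submersions,
  which are embedded submanifolds \<open>A\<close> of a product: in a chart \<open>(U, \<phi>)\<close> adapted to \<open>A\<close>, the sets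
  \<open>\<phi> ` (A \<inter> W)\<close> are open in a linear subspace and \<open>\<phi>\<close> restricted to \<open>A\<close> is a chart of \<open>A\<close>, so that
  the condition is smoothness with respect to the submanifold structure of \<open>A\<close>.\<close>

definition smooth_map_on ::
  "('p, 'e::euclidean_space) manifold \<Rightarrow> 'p set \<Rightarrow> ('q, 'f::euclidean_space) manifold
     \<Rightarrow> ('p \<Rightarrow> 'q) \<Rightarrow> bool" where
  "smooth_map_on M A N f \<longleftrightarrow>
     A \<subseteq> points M \<and> f \<in> A \<rightarrow> points N \<and>
     (\<forall>p\<in>A. \<exists>(U, \<phi>) \<in> atlas M. \<exists>(V, \<psi>) \<in> atlas N. \<exists>W.
        openin (mtop M) W \<and> p \<in> W \<and> W \<subseteq> U \<and> f ` (A \<inter> W) \<subseteq> V \<and>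
        smooth_on (\<phi> ` (A \<inter> W)) (\<psi> \<circ> f \<circ> inv_into U \<phi>))"

abbreviation smooth_map ::
  "('p, 'e::euclidean_space) manifold \<Rightarrow> ('q, 'f::euclidean_space) manifold
     \<Rightarrow> ('p \<Rightarrow> 'q) \<Rightarrow> bool" where
  "smooth_map M N f \<equiv> smooth_map_on M (points M) N f"

text \<open>The derivative of a chart representative at \<open>\<phi> p\<close> is taken within \<open>\<phi> ` U\<close>, which is open in
  the model space of \<open>M\<close>; hence \<open>D\<close> is determined on that model space.\<close>

definition submersion ::
  "('p, 'e::euclidean_space) manifold \<Rightarrow> ('q, 'f::euclidean_space) manifold
     \<Rightarrow> ('p \<Rightarrow> 'q) \<Rightarrow> bool" where
  "submersion M N f \<longleftrightarrow>
     smooth_map M N f \<and>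
     (\<forall>(U, \<phi>) \<in> atlas M. \<forall>(V, \<psi>) \<in> atlas N. \<forall>p\<in>U. f p \<in> V \<longrightarrow>
        (\<exists>D. (\<psi> \<circ> f \<circ> inv_into U \<phi> has_derivative D) (at (\<phi> p) within \<phi> ` U) \<and>
             D ` model M = model N))"

definition prod_manifold ::
  "('p, 'e) manifold \<Rightarrow> ('q, 'f) manifold \<Rightarrow> ('p \<times> 'q, 'e \<times> 'f) manifold" where
  "prod_manifold M N =
     \<lparr> mtop = prod_topology (mtop M) (mtop N),
       model = model M \<times> model N,
       atlas = {(U \<times> V, map_prod \<phi> \<psi>) | U \<phi> V \<psi>. (U, \<phi>) \<in> atlas M \<and> (V, \<psi>) \<in> atlas N} \<rparr>"

section \<open>Lie groupoids\<close>

text \<open>The product \<open>mult G g h\<close> is only meaningful for \<open>src G g = tgt G h\<close>.\<close>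

record ('g, 'x, 'e, 'f) groupoid_data =
  arrow_mfd :: "('g, 'e) manifold"
  object_mfd :: "('x, 'f) manifold"
  src :: "'g \<Rightarrow> 'x"
  tgt :: "'g \<Rightarrow> 'x"
  unit_at :: "'x \<Rightarrow> 'g"
  ginv :: "'g \<Rightarrow> 'g"
  mult :: "'g \<Rightarrow> 'g \<Rightarrow> 'g"

abbreviation arrows :: "('g, 'x, 'e, 'f) groupoid_data \<Rightarrow> 'g set" where
  "arrows G \<equiv> points (arrow_mfd G)"

abbreviation objects :: "('g, 'x, 'e, 'f) groupoid_data \<Rightarrow> 'x set" where
  "objects G \<equiv> points (object_mfd G)"

definition composable :: "('g, 'x, 'e, 'f) groupoid_data \<Rightarrow> ('g \<times> 'g) set" where
  "composable G = {(g, h). g \<in> arrows G \<and> h \<in> arrows G \<and> src G g = tgt G h}"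

locale groupoid =
  fixes G :: "('g, 'x, 'e, 'f) groupoid_data"
  assumes src_surj: "src G ` arrows G = objects G"
    and tgt_surj: "tgt G ` arrows G = objects G"
    and unit_closed: "x \<in> objects G \<Longrightarrow> unit_at G x \<in> arrows G"
    and ginv_closed: "g \<in> arrows G \<Longrightarrow> ginv G g \<in> arrows G"
    and mult_closed: "(g, h) \<in> composable G \<Longrightarrow> mult G g h \<in> arrows G"
    and src_mult: "(g, h) \<in> composable G \<Longrightarrow> src G (mult G g h) = src G h"
    and tgt_mult: "(g, h) \<in> composable G \<Longrightarrow> tgt G (mult G g h) = tgt G g"
    and mult_assoc: "(g, h) \<in> composable G \<Longrightarrow> (h, k) \<in> composable G \<Longrightarrow>
          mult G (mult G g h) k = mult G g (mult G h k)"
    and src_unit: "x \<in> objects G \<Longrightarrow> src G (unit_at G x) = x"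
    and tgt_unit: "x \<in> objects G \<Longrightarrow> tgt G (unit_at G x) = x"
    and unit_left: "g \<in> arrows G \<Longrightarrow> mult G (unit_at G (tgt G g)) g = g"
    and unit_right: "g \<in> arrows G \<Longrightarrow> mult G g (unit_at G (src G g)) = g"
    and src_ginv: "g \<in> arrows G \<Longrightarrow> src G (ginv G g) = tgt G g"
    and tgt_ginv: "g \<in> arrows G \<Longrightarrow> tgt G (ginv G g) = src G g"
    and ginv_left: "g \<in> arrows G \<Longrightarrow> mult G (ginv G g) g = unit_at G (src G g)"
    and ginv_right: "g \<in> arrows G \<Longrightarrow> mult G g (ginv G g) = unit_at G (tgt G g)"

locale lie_groupoid = groupoid G
  for G :: "('g, 'x, 'e::euclidean_space, 'f::euclidean_space) groupoid_data" +
  assumes manifold_objects: "smooth_manifold (object_mfd G)"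
    and Hausdorff_objects: "Hausdorff_space (mtop (object_mfd G))"
    and manifold_arrows: "smooth_manifold (arrow_mfd G)"
    and submersion_src: "submersion (arrow_mfd G) (object_mfd G) (src G)"
    and Hausdorff_src_fibres: "x \<in> objects G \<Longrightarrow>
          Hausdorff_space (subtopology (mtop (arrow_mfd G)) {g \<in> arrows G. src G g = x})"
    and smooth_tgt: "smooth_map (arrow_mfd G) (object_mfd G) (tgt G)"
    and smooth_unit: "smooth_map (object_mfd G) (arrow_mfd G) (unit_at G)"
    and smooth_ginv: "smooth_map (arrow_mfd G) (arrow_mfd G) (ginv G)"
    and smooth_mult: "smooth_map_on (prod_manifold (arrow_mfd G) (arrow_mfd G)) (composable G)
          (arrow_mfd G) (\<lambda>(g, h). mult G g h)"

definition prod_groupoid ::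
  "('g, 'x, 'e, 'f) groupoid_data \<Rightarrow> ('h, 'y, 'c, 'd) groupoid_data
     \<Rightarrow> ('g \<times> 'h, 'x \<times> 'y, 'e \<times> 'c, 'f \<times> 'd) groupoid_data" where
  "prod_groupoid G H =
     \<lparr> arrow_mfd = prod_manifold (arrow_mfd G) (arrow_mfd H),
       object_mfd = prod_manifold (object_mfd G) (object_mfd H),
       src = map_prod (src G) (src H),
       tgt = map_prod (tgt G) (tgt H),
       unit_at = map_prod (unit_at G) (unit_at H),
       ginv = map_prod (ginv G) (ginv H),
       mult = (\<lambda>(g, h) (g', h'). (mult G g g', mult H h h')) \<rparr>"

section \<open>Left actions\<close>

definition fibre_prod ::
  "('k, 'y, 'c, 'd) groupoid_data \<Rightarrow> ('n \<Rightarrow> 'y) \<Rightarrow> ('n, 'e) manifold \<Rightarrow> ('k \<times> 'n) set" where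
  "fibre_prod K J N = {(k, n). k \<in> arrows K \<and> n \<in> points N \<and> src K k = J n}"

locale left_action = lie_groupoid K
  for K :: "('k, 'y, 'c::euclidean_space, 'd::euclidean_space) groupoid_data" +
  fixes N :: "('n, 'e::euclidean_space) manifold"
    and J :: "'n \<Rightarrow> 'y"
    and \<Psi> :: "'k \<times> 'n \<Rightarrow> 'n"
  assumes manifold_space: "smooth_manifold N"
    and smooth_momentum: "smooth_map N (object_mfd K) J"
    and smooth_action: "smooth_map_on (prod_manifold (arrow_mfd K) N) (fibre_prod K J N) N \<Psi>"
    and momentum_action: "(k, n) \<in> fibre_prod K J N \<Longrightarrow> J (\<Psi> (k, n)) = tgt K k"
    and action_assoc: "(k1, k2) \<in> composable K \<Longrightarrow> (k2, n) \<in> fibre_prod K J N \<Longrightarrow>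
          \<Psi> (k1, \<Psi> (k2, n)) = \<Psi> (mult K k1 k2, n)"
    and action_unit: "n \<in> points N \<Longrightarrow> \<Psi> (unit_at K (J n), n) = n"

section \<open>Generalized conjugation\<close>

definition conj_momentum :: "('g, 'x, 'e, 'f) groupoid_data \<Rightarrow> 'g \<Rightarrow> 'x \<times> 'x" where
  "conj_momentum G g = (tgt G g, src G g)"

definition conj_domain :: "('g, 'x, 'e, 'f) groupoid_data \<Rightarrow> (('g \<times> 'g) \<times> 'g) set" where
  "conj_domain G = {((g1, g2), g3). g1 \<in> arrows G \<and> g2 \<in> arrows G \<and> g3 \<in> arrows G \<and>
     src G g1 = tgt G g3 \<and> src G g2 = src G g3}"

text \<open>The map is undefined outside of \<^term>\<open>conj_domain G\<close>, so that being an action includes that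
  this set is the fibre product of the action.\<close>

definition conj_map :: "('g, 'x, 'e, 'f) groupoid_data \<Rightarrow> ('g \<times> 'g) \<times> 'g \<Rightarrow> 'g" where
  "conj_map G =
     restrict (\<lambda>((g1, g2), g3). mult G (mult G g1 g3) (ginv G g2)) (conj_domain G)"

end

theory Submission
  imports Defs
begin

text \<open>Algebraically, conjugation is an action because
  \<open>h\<^sub>1 (g\<^sub>1 n g\<^sub>2\<^sup>-\<^sup>1) h\<^sub>2\<^sup>-\<^sup>1 = (h\<^sub>1 g\<^sub>1) n (h\<^sub>2 g\<^sub>2)\<^sup>-\<^sup>1\<close>, that is, by associativity and by the rule
  for the inverse of a product (\<open>ginv_mult\<close>).

  Smoothness is formal once smooth maps between manifolds are known to be closed under
  composition and pairing and to contain the projections: the momentum, the conjugation map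
  and the structure maps of the product groupoid are all built from the structure maps of
  \<open>G\<close> by these operations. These closure properties rest on two facts. The first is the chain
  rule for \<open>C\<^sup>k\<close> maps (\<open>Ck_on_compose\<close>), which passes to maps on arbitrary sets because local
  extensions can be composed. The second is that smoothness at a point may be tested in any
  pair of charts around the point and its image (\<open>smooth_map_on_in_charts\<close>), which needs the
  compatibility of charts and the continuity of smooth maps (\<open>smooth_map_on_imp_continuous\<close>).
  Smoothness on a subset \<open>A\<close> being defined by local extensions, the closure properties hold
  for arbitrary \<open>A\<close>, and so in particular for the fibre products on which the multiplication
  and the action are defined.

  What remains is that the product groupoid is a Lie groupoid: charts, submersions and
  Hausdorff source fibres are all compatible with products.\<close>

section \<open>Calculus of \<open>C\<^sup>k\<close> maps on open sets\<close>

lemma Ck_on_cong: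
  assumes "open U" "\<And>x. x \<in> U \<Longrightarrow> f x = g x" "Ck_on k U f"
  shows "Ck_on k U g"
  using assms(2,3)
proof (induction k arbitrary: f g)
  case 0
  then show ?case by (auto cong: continuous_on_cong)
next
  case (Suc k)
  have diff: "f differentiable (at x)" if "x \<in> U" for x
    using Suc.prems(2) that by simp
  have "(g has_derivative frechet_derivative f (at x)) (at x)" if "x \<in> U" for x
    using Suc.prems(1)
    by (rule has_derivative_transform_within_open
        [OF diff[OF that, unfolded frechet_derivative_works] assms(1) that])
  then have "g differentiable (at x)" "frechet_derivative f (at x) = frechet_derivative g (at x)"
    if "x \<in> U" for x
    using that frechet_derivative_at differentiable_def by blast+
  moreover have "Ck_on k U (\<lambda>x. frechet_derivative g (at x) v)" for v
    by (rule Suc.IH[where f = "\<lambda>x. frechet_derivative f (at x) v"])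
      (use Suc.prems calculation in auto)
  ultimately show ?case by simp
qed

lemma Ck_on_Suc_intro:
  assumes "open U" "\<And>x. x \<in> U \<Longrightarrow> (f has_derivative f' x) (at x)"
    and "\<And>v. Ck_on k U (\<lambda>x. f' x v)"
  shows "Ck_on (Suc k) U f"
proof -
  have "f' x v = frechet_derivative f (at x) v" if "x \<in> U" for x v
    using assms(2)[OF that] frechet_derivative_at by fastforce
  then have "Ck_on k U (\<lambda>x. frechet_derivative f (at x) v)" for v
    by (rule Ck_on_cong[OF assms(1) _ assms(3)])
  then show ?thesis
    using assms(2) by (auto simp: differentiable_def)
qed

lemma Ck_on_Suc_has_derivative:
  "Ck_on (Suc k) U f \<Longrightarrow> x \<in> U \<Longrightarrow> (f has_derivative frechet_derivative f (at x)) (at x)"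
  by (simp add: frechet_derivative_works[symmetric])

lemma Ck_on_Suc_lower: "Ck_on (Suc k) U f \<Longrightarrow> Ck_on k U f"
proof (induction k arbitrary: f)
  case 0
  then show ?case
    by (auto intro: continuous_at_imp_continuous_on differentiable_imp_continuous_within)
next
  case (Suc k)
  then show ?case by (metis Ck_on.simps(2))
qed

lemma Ck_on_continuous: "Ck_on k U f \<Longrightarrow> continuous_on U f"
proof (induction k)
  case (Suc k)
  then show ?case by (blast dest: Ck_on_Suc_lower)
qed simp

lemma Ck_on_subset: "Ck_on k U f \<Longrightarrow> V \<subseteq> U \<Longrightarrow> Ck_on k V f"
  by (induction k arbitrary: f) (auto intro: continuous_on_subset)

lemma Ck_on_const: "open U \<Longrightarrow> Ck_on k U (\<lambda>_. c)"
proof (induction k arbitrary: c)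
  case (Suc k)
  then show ?case by (intro Ck_on_Suc_intro[where f' = "\<lambda>_ _. 0"]) auto
qed auto

lemma Ck_on_bounded_linear:
  assumes "open U" "bounded_linear L" "Ck_on k U f"
  shows "Ck_on k U (\<lambda>x. L (f x))"
  using assms(3)
proof (induction k arbitrary: f)
  case 0
  then show ?case using assms(2) by (auto intro: bounded_linear.continuous_on)
next
  case (Suc k)
  show ?case
  proof (rule Ck_on_Suc_intro[OF assms(1)])
    show "((\<lambda>x. L (f x)) has_derivative (\<lambda>v. L (frechet_derivative f (at x) v))) (at x)"
      if "x \<in> U" for x
      using bounded_linear.has_derivative[OF assms(2) Ck_on_Suc_has_derivative[OF Suc.prems that]] .
    show "Ck_on k U (\<lambda>x. L (frechet_derivative f (at x) v))" for v
      using Suc by auto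
  qed
qed

lemma Ck_on_linear:
  assumes "open U" "bounded_linear L"
  shows "Ck_on k U L"
proof (cases k)
  case 0
  then show ?thesis using assms linear_continuous_on by auto
next
  case (Suc k')
  show ?thesis unfolding Suc
    by (rule Ck_on_Suc_intro[where f' = "\<lambda>_. L"])
      (use assms bounded_linear_imp_has_derivative Ck_on_const in auto)
qed

lemma Ck_on_add:
  assumes "open U" "Ck_on k U f" "Ck_on k U g"
  shows "Ck_on k U (\<lambda>x. f x + g x)"
  using assms(2,3)
proof (induction k arbitrary: f g)
  case 0
  then show ?case by (auto intro: continuous_on_add)
next
  case (Suc k)
  show ?case
  proof (rule Ck_on_Suc_intro[OF assms(1)])
    show "((\<lambda>x. f x + g x) has_derivative
        (\<lambda>v. frechet_derivative f (at x) v + frechet_derivative g (at x) v)) (at x)"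
      if "x \<in> U" for x
      using that by (intro has_derivative_add Ck_on_Suc_has_derivative[OF Suc.prems(1)]
          Ck_on_Suc_has_derivative[OF Suc.prems(2)])
    show "Ck_on k U (\<lambda>x. frechet_derivative f (at x) v + frechet_derivative g (at x) v)" for v
      using Suc by auto
  qed
qed

lemma Ck_on_sum:
  assumes "open U" "finite I" "\<And>i. i \<in> I \<Longrightarrow> Ck_on k U (f i)"
  shows "Ck_on k U (\<lambda>x. \<Sum>i\<in>I. f i x)"
  using assms(2,3)
  by (induction I rule: finite_induct) (auto intro: Ck_on_const Ck_on_add assms(1))

lemma Ck_on_scaleR:
  assumes "open U" "Ck_on k U a" "Ck_on k U f"
  shows "Ck_on k U (\<lambda>x. a x *\<^sub>R f x)"
  using assms(2,3)
proof (induction k arbitrary: a f)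
  case 0
  then show ?case by (auto intro: continuous_on_scaleR)
next
  case (Suc k)
  show ?case
  proof (rule Ck_on_Suc_intro[OF assms(1)])
    show "((\<lambda>x. a x *\<^sub>R f x) has_derivative
        (\<lambda>v. a x *\<^sub>R frechet_derivative f (at x) v + frechet_derivative a (at x) v *\<^sub>R f x)) (at x)"
      if "x \<in> U" for x
      using that by (intro has_derivative_scaleR Ck_on_Suc_has_derivative[OF Suc.prems(1)]
          Ck_on_Suc_has_derivative[OF Suc.prems(2)])
    show "Ck_on k U
        (\<lambda>x. a x *\<^sub>R frechet_derivative f (at x) v + frechet_derivative a (at x) v *\<^sub>R f x)" for v
      by (intro Ck_on_add assms(1) Suc.IH)
        (use Suc.prems Ck_on_Suc_lower in \<open>auto simp del: Ck_on.simps(2)\<close>, auto)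
  qed
qed

text \<open>By the chain rule and an expansion in the standard basis, the directional derivatives of
  \<open>g \<circ> f\<close> are the functions \<open>\<Sum>i. (D\<^sub>v f \<bullet> i) (D\<^sub>i g \<circ> f)\<close>. The factors \<open>D\<^sub>i g \<circ> f\<close> are again
  composites, of one degree of differentiability less, so an induction on \<open>k\<close> applies.\<close>

lemma Ck_on_compose:
  assumes "open U" "open V" "f ` U \<subseteq> V" "Ck_on k U f" "Ck_on k V g"
  shows "Ck_on k U (\<lambda>x. g (f x))"
  using assms(3-5)
proof (induction k arbitrary: f g)
  case 0
  then show ?case by (auto intro: continuous_on_compose2)
next
  case (Suc k)
  let ?f' = "\<lambda>x. frechet_derivative f (at x)"
  let ?g' = "\<lambda>y. frechet_derivative g (at y)"
  have expand: "?g' (f x) w = (\<Sum>i\<in>Basis. (w \<bullet> i) *\<^sub>R ?g' (f x) i)" if "x \<in> U" for x w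
  proof -
    have "linear (?g' (f x))"
      using Ck_on_Suc_has_derivative[OF Suc.prems(3)] Suc.prems(1) that
      by (blast intro: has_derivative_linear)
    then have "?g' (f x) (\<Sum>i\<in>Basis. (w \<bullet> i) *\<^sub>R i) = (\<Sum>i\<in>Basis. (w \<bullet> i) *\<^sub>R ?g' (f x) i)"
      by (simp add: linear_sum linear_scale)
    then show ?thesis by (simp add: euclidean_representation)
  qed
  show ?case
  proof (rule Ck_on_Suc_intro[OF assms(1)])
    show "((\<lambda>x. g (f x)) has_derivative (\<lambda>v. \<Sum>i\<in>Basis. (?f' x v \<bullet> i) *\<^sub>R ?g' (f x) i)) (at x)"
      if "x \<in> U" for x
    proof -
      have "((\<lambda>x. g (f x)) has_derivative (\<lambda>v. ?g' (f x) (?f' x v))) (at x)"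
        using Ck_on_Suc_has_derivative[OF Suc.prems(2) that]
          Ck_on_Suc_has_derivative[OF Suc.prems(3)] Suc.prems(1) that
        by (blast intro: has_derivative_compose)
      moreover have "(\<lambda>v. ?g' (f x) (?f' x v))
          = (\<lambda>v. \<Sum>i\<in>Basis. (?f' x v \<bullet> i) *\<^sub>R ?g' (f x) i)"
        by (rule ext) (rule expand[OF that])
      ultimately show ?thesis by (simp only:)
    qed
    show "Ck_on k U (\<lambda>x. \<Sum>i\<in>Basis. (?f' x v \<bullet> i) *\<^sub>R ?g' (f x) i)" for v
    proof (intro Ck_on_sum Ck_on_scaleR assms(1) finite_Basis)
      fix i :: 'b
      have "Ck_on k U (\<lambda>x. ?f' x v)" using Suc.prems by simp
      then show "Ck_on k U (\<lambda>x. ?f' x v \<bullet> i)"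
        by (rule Ck_on_bounded_linear[OF assms(1) bounded_linear_inner_left])
      show "Ck_on k U (\<lambda>x. ?g' (f x) i)"
        by (intro Suc.IH Suc.prems(1) Ck_on_Suc_lower[OF Suc.prems(2)]) (use Suc.prems in simp)
    qed
  qed
qed

lemma Ck_on_Pair:
  assumes "open U" "Ck_on k U f" "Ck_on k U g"
  shows "Ck_on k U (\<lambda>x. (f x, g x))"
proof -
  have "Ck_on k U (\<lambda>x. (f x, 0) + (0, g x))"
    using assms
    by (intro Ck_on_add Ck_on_bounded_linear[where L = "\<lambda>y. (y, 0)"]
        Ck_on_bounded_linear[where L = "\<lambda>y. (0, y)"] bounded_linear_Pair
        bounded_linear_ident bounded_linear_zero)
  then show ?thesis by simp
qed

section \<open>Smooth maps on arbitrary subsets of Euclidean spaces\<close>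

lemma smooth_on_cong_subset:
  assumes f: "smooth_on S f" and T: "T \<subseteq> S" "\<And>x. x \<in> T \<Longrightarrow> f x = g x"
  shows "smooth_on T g"
  unfolding smooth_on_def
proof
  fix x assume "x \<in> T"
  then have x: "x \<in> S" using T(1) by blast
  obtain U F where U: "open U" "x \<in> U" "\<forall>k. Ck_on k U F" "\<forall>y\<in>S \<inter> U. F y = f y"
    using f x unfolding smooth_on_def by meson
  have "\<forall>y\<in>T \<inter> U. F y = g y" using U(4) T by auto
  with U(1-3) show "\<exists>U F. open U \<and> x \<in> U \<and> (\<forall>k. Ck_on k U F) \<and> (\<forall>y\<in>T \<inter> U. F y = g y)"
    by (intro exI[of _ U] exI[of _ F] conjI)
qed

lemma smooth_on_subset: "smooth_on S f \<Longrightarrow> T \<subseteq> S \<Longrightarrow> smooth_on T f"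
  by (rule smooth_on_cong_subset[OF _ _ refl])

lemma smooth_on_cong: "smooth_on S f \<Longrightarrow> (\<And>x. x \<in> S \<Longrightarrow> f x = g x) \<Longrightarrow> smooth_on S g"
  by (rule smooth_on_cong_subset[OF _ subset_refl])

lemma smooth_on_linear:
  assumes "bounded_linear L" shows "smooth_on S L"
proof -
  have "\<forall>k. Ck_on k UNIV L" using Ck_on_linear[OF open_UNIV assms] by simp
  then show ?thesis
    unfolding smooth_on_def by (intro ballI exI[of _ UNIV] exI[of _ L]) simp
qed

lemma smooth_on_continuous:
  assumes "smooth_on S f" shows "continuous_on S f"
proof -
  have "continuous (at x within S) f" if x: "x \<in> S" for x
  proof -
    obtain U F where U: "open U" "x \<in> U" "Ck_on 0 U F" "\<forall>y\<in>S \<inter> U. F y = f y"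
      using assms x unfolding smooth_on_def by meson
    have "continuous (at x within S) F"
      using U by (simp add: continuous_on_eq_continuous_at continuous_at_imp_continuous_at_within)
    moreover have "eventually (\<lambda>y. F y = f y) (at x within S)"
      using U unfolding eventually_at_topological by blast
    ultimately show ?thesis
      using U x unfolding continuous_within by (auto elim: Lim_transform_eventually)
  qed
  then show ?thesis by (simp add: continuous_on_eq_continuous_within)
qed

lemma smooth_on_compose:
  assumes f: "smooth_on S f" and g: "smooth_on T g" and sub: "f ` S \<subseteq> T"
  shows "smooth_on S (g \<circ> f)"
  unfolding smooth_on_def
proof
  fix x assume x: "x \<in> S"
  obtain U F where U: "open U" "x \<in> U" "\<forall>k. Ck_on k U F" "\<forall>y\<in>S \<inter> U. F y = f y"
    using f x unfolding smooth_on_def by meson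
  have "f x \<in> T" using sub x by auto
  then obtain V H where V: "open V" "f x \<in> V" "\<forall>k. Ck_on k V H" "\<forall>y\<in>T \<inter> V. H y = g y"
    using g unfolding smooth_on_def by meson
  let ?W = "U \<inter> F -` V"
  have W: "open ?W"
    using U V Ck_on_continuous by (metis continuous_open_preimage)
  have "Ck_on k ?W (\<lambda>x. H (F x))" for k
    by (rule Ck_on_compose[where V = V, OF W V(1)]) (use U V in \<open>auto intro: Ck_on_subset\<close>)
  then show "\<exists>U F. open U \<and> x \<in> U \<and> (\<forall>k. Ck_on k U F) \<and> (\<forall>y\<in>S \<inter> U. F y = (g \<circ> f) y)"
    using W U V x sub by (intro exI[of _ ?W] exI[of _ "\<lambda>x. H (F x)"]) (auto simp: image_subset_iff)
qed

lemma smooth_on_Pair: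
  assumes f: "smooth_on S f" and g: "smooth_on S g"
  shows "smooth_on S (\<lambda>x. (f x, g x))"
  unfolding smooth_on_def
proof
  fix x assume x: "x \<in> S"
  obtain U F where U: "open U" "x \<in> U" "\<forall>k. Ck_on k U F" "\<forall>y\<in>S \<inter> U. F y = f y"
    using f x unfolding smooth_on_def by meson
  obtain V H where V: "open V" "x \<in> V" "\<forall>k. Ck_on k V H" "\<forall>y\<in>S \<inter> V. H y = g y"
    using g x unfolding smooth_on_def by meson
  have "Ck_on k (U \<inter> V) (\<lambda>x. (F x, H x))" for k
    using U V by (intro Ck_on_Pair) (auto intro: Ck_on_subset)
  then show "\<exists>U F. open U \<and> x \<in> U \<and> (\<forall>k. Ck_on k U F) \<and> (\<forall>y\<in>S \<inter> U. F y = (f y, g y))"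
    using U V by (intro exI[of _ "U \<inter> V"] exI[of _ "\<lambda>x. (F x, H x)"]) auto
qed

lemma smooth_on_map_prod:
  assumes "smooth_on S f" "smooth_on T g"
  shows "smooth_on (S \<times> T) (map_prod f g)"
proof -
  have "smooth_on (S \<times> T) (f \<circ> fst)" "smooth_on (S \<times> T) (g \<circ> snd)"
    by (rule smooth_on_compose[OF smooth_on_linear[OF bounded_linear_fst] assms(1)], force)
      (rule smooth_on_compose[OF smooth_on_linear[OF bounded_linear_snd] assms(2)], force)
  from smooth_on_Pair[OF this] show ?thesis
    by (rule smooth_on_cong) auto
qed

section \<open>Smooth maps between manifolds\<close>

lemma inv_into_map_prod:
  assumes "inj_on \<phi> U" "inj_on \<psi> V" "a \<in> \<phi> ` U" "b \<in> \<psi> ` V"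
  shows "inv_into (U \<times> V) (map_prod \<phi> \<psi>) (a, b) = (inv_into U \<phi> a, inv_into V \<psi> b)"
  by (rule inv_into_f_eq[OF map_prod_inj_on[OF assms(1,2)]])
    (use assms(3,4) in \<open>simp_all add: inv_into_into f_inv_into_f\<close>)

context smooth_manifold
begin

lemma chart_subset: "(U, \<phi>) \<in> atlas M \<Longrightarrow> U \<subseteq> points M"
  using chart_domain openin_subset by blast

lemma chart_inj: "(U, \<phi>) \<in> atlas M \<Longrightarrow> inj_on \<phi> U"
  using homeomorphic_imp_injective_map[OF chart_homeo[of U \<phi>]] chart_subset[of U \<phi>]
  by (simp add: inf.absorb2)

lemma inv_chart: "(U, \<phi>) \<in> atlas M \<Longrightarrow> x \<in> U \<Longrightarrow> inv_into U \<phi> (\<phi> x) = x"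
  by (rule inv_into_f_f[OF chart_inj])

lemma chart_at:
  assumes "p \<in> points M"
  obtains U \<phi> where "(U, \<phi>) \<in> atlas M" "p \<in> U"
  using charts_cover[OF assms] by auto

lemma openin_chart_preimage:
  assumes "(U, \<phi>) \<in> atlas M" "open S"
  shows "openin (mtop M) {x \<in> U. \<phi> x \<in> S}"
proof -
  have "continuous_map (subtopology (mtop M) U) euclidean \<phi>"
    using homeomorphic_imp_continuous_map[OF chart_homeo[OF assms(1)]]
    by (simp add: continuous_map_in_subtopology)
  then have "openin (subtopology (mtop M) U) {x \<in> topspace (subtopology (mtop M) U). \<phi> x \<in> S}"
    using assms(2) by (metis openin_continuous_map_preimage open_openin)
  then show ?thesis
    using chart_domain[OF assms(1)] chart_subset[OF assms(1)]
    by (simp add: openin_open_subtopology inf.absorb2)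
qed

lemma open_chart_image:
  assumes "(U, \<phi>) \<in> atlas M" "openin (mtop M) T"
  obtains S where "open S" "\<phi> ` (U \<inter> T) = \<phi> ` U \<inter> S"
proof -
  have "openin (subtopology (mtop M) U) (U \<inter> T)"
    using assms(2) by (simp add: openin_subtopology_Int2)
  then have "openin (top_of_set (\<phi> ` U)) (\<phi> ` (U \<inter> T))"
    using homeomorphic_imp_open_map[OF chart_homeo[OF assms(1)]] by (simp add: open_map_def)
  then show ?thesis using that by (auto simp: openin_open)
qed

end

text \<open>Smooth maps are continuous: read in the charts supplied by the definition, the map has a
  continuous representative, and charts are homeomorphisms onto their images.\<close>

lemma smooth_map_on_imp_continuous:
  assumes M: "smooth_manifold M" and N: "smooth_manifold N"
    and f: "smooth_map_on M A N f" and p: "p \<in> A" and T: "openin (mtop N) T" "f p \<in> T"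
  obtains W where "openin (mtop M) W" "p \<in> W" "f ` (A \<inter> W) \<subseteq> T"
proof -
  interpret M: smooth_manifold M by fact
  interpret N: smooth_manifold N by fact
  obtain U \<phi> V \<psi> W where U: "(U, \<phi>) \<in> atlas M" and V: "(V, \<psi>) \<in> atlas N"
    and W: "openin (mtop M) W" "p \<in> W" "W \<subseteq> U" "f ` (A \<inter> W) \<subseteq> V"
    and sm: "smooth_on (\<phi> ` (A \<inter> W)) (\<psi> \<circ> f \<circ> inv_into U \<phi>)"
    using f p unfolding smooth_map_on_def by (auto; blast)
  let ?h = "\<psi> \<circ> f \<circ> inv_into U \<phi>"
  obtain S where S: "open S" "\<psi> ` (V \<inter> T) = \<psi> ` V \<inter> S"
    using N.open_chart_image[OF V T(1)] .
  have "continuous_on (\<phi> ` (A \<inter> W)) ?h" using sm by (rule smooth_on_continuous)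
  then obtain R where R: "open R" "R \<inter> \<phi> ` (A \<inter> W) = ?h -` S \<inter> \<phi> ` (A \<inter> W)"
    using S(1) unfolding continuous_on_open_invariant by meson
  have iff: "f x \<in> T \<longleftrightarrow> \<phi> x \<in> R" if x: "x \<in> A \<inter> W" for x
  proof -
    have xU: "x \<in> U" and fx: "f x \<in> V" using x W by auto
    have "\<phi> x \<in> R \<longleftrightarrow> ?h (\<phi> x) \<in> S" using R(2) x by blast
    also have "?h (\<phi> x) = \<psi> (f x)" using xU by (simp add: M.inv_chart[OF U])
    also have "\<psi> (f x) \<in> S \<longleftrightarrow> \<psi> (f x) \<in> \<psi> ` (V \<inter> T)" using S(2) fx by blast
    also have "\<dots> \<longleftrightarrow> f x \<in> T"
      using fx N.chart_inj[OF V] by (auto simp: inj_on_def)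
    finally show ?thesis by simp
  qed
  show ?thesis
  proof (rule that)
    show "openin (mtop M) (W \<inter> {x \<in> U. \<phi> x \<in> R})"
      using W(1) M.openin_chart_preimage[OF U R(1)] by blast
    show "p \<in> W \<inter> {x \<in> U. \<phi> x \<in> R}" using iff[of p] p W T by auto
    show "f ` (A \<inter> (W \<inter> {x \<in> U. \<phi> x \<in> R})) \<subseteq> T" using iff by auto
  qed
qed

text \<open>The definition of smoothness only provides some pair of charts around a point and its image;
  composing with the two smooth transition maps shows that every pair of charts will do. This
  is what allows charts to be matched when two smooth maps are composed or paired.\<close>

lemma smooth_map_on_in_charts:
  assumes M: "smooth_manifold M" and N: "smooth_manifold N"
    and f: "smooth_map_on M A N f" and p: "p \<in> A"
    and U: "(U, \<phi>) \<in> atlas M" "p \<in> U" and V: "(V, \<psi>) \<in> atlas N" "f p \<in> V"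
  obtains W where "openin (mtop M) W" "p \<in> W" "W \<subseteq> U" "f ` (A \<inter> W) \<subseteq> V"
    "smooth_on (\<phi> ` (A \<inter> W)) (\<psi> \<circ> f \<circ> inv_into U \<phi>)"
proof -
  interpret M: smooth_manifold M by fact
  interpret N: smooth_manifold N by fact
  obtain U0 \<phi>0 V0 \<psi>0 W0 where U0: "(U0, \<phi>0) \<in> atlas M" and V0: "(V0, \<psi>0) \<in> atlas N"
    and W0: "openin (mtop M) W0" "p \<in> W0" "W0 \<subseteq> U0" "f ` (A \<inter> W0) \<subseteq> V0"
    and sm: "smooth_on (\<phi>0 ` (A \<inter> W0)) (\<psi>0 \<circ> f \<circ> inv_into U0 \<phi>0)"
    using f p unfolding smooth_map_on_def by (auto; blast)
  obtain W1 where W1: "openin (mtop M) W1" "p \<in> W1" "f ` (A \<inter> W1) \<subseteq> V"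
    using smooth_map_on_imp_continuous[OF M N f p N.chart_domain[OF V(1)] V(2)] .
  let ?W = "W0 \<inter> W1 \<inter> U"
  have tU: "smooth_on (\<phi> ` (A \<inter> ?W)) (\<phi>0 \<circ> inv_into U \<phi>)"
    using M.charts_compatible[OF U(1) U0] by (rule smooth_on_subset) (use W0 in auto)
  have tV: "smooth_on (\<psi>0 ` (V0 \<inter> V)) (\<psi> \<circ> inv_into V0 \<psi>0)"
    using N.charts_compatible[OF V0 V(1)] .
  have "smooth_on (\<phi> ` (A \<inter> ?W)) ((\<psi>0 \<circ> f \<circ> inv_into U0 \<phi>0) \<circ> (\<phi>0 \<circ> inv_into U \<phi>))"
    using sm by (rule smooth_on_compose[OF tU]) (auto simp: M.inv_chart[OF U(1)])
  moreover have "((\<psi>0 \<circ> f \<circ> inv_into U0 \<phi>0) \<circ> (\<phi>0 \<circ> inv_into U \<phi>)) (\<phi> x) = \<psi>0 (f x)"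
    if "x \<in> ?W" for x
    using that W0(3) by (auto simp: M.inv_chart[OF U(1)] M.inv_chart[OF U0])
  ultimately have "smooth_on (\<phi> ` (A \<inter> ?W))
      ((\<psi> \<circ> inv_into V0 \<psi>0) \<circ> ((\<psi>0 \<circ> f \<circ> inv_into U0 \<phi>0) \<circ> (\<phi>0 \<circ> inv_into U \<phi>)))"
    using W0(4) W1(3) by (intro smooth_on_compose[OF _ tV]) (force simp del: comp_apply)+
  then have sm': "smooth_on (\<phi> ` (A \<inter> ?W)) (\<psi> \<circ> f \<circ> inv_into U \<phi>)"
  proof (rule smooth_on_cong)
    fix y assume "y \<in> \<phi> ` (A \<inter> ?W)"
    then obtain x where x: "y = \<phi> x" "x \<in> A" "x \<in> W0" "x \<in> W1" "x \<in> U" by auto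
    then have "x \<in> U0" "f x \<in> V0" using W0 by auto
    with x show "((\<psi> \<circ> inv_into V0 \<psi>0) \<circ> ((\<psi>0 \<circ> f \<circ> inv_into U0 \<phi>0) \<circ> (\<phi>0 \<circ> inv_into U \<phi>))) y
        = (\<psi> \<circ> f \<circ> inv_into U \<phi>) y"
      by (simp add: M.inv_chart[OF U(1)] M.inv_chart[OF U0] N.inv_chart[OF V0])
  qed
  show ?thesis
  proof (rule that[of ?W])
    show "openin (mtop M) ?W" using W0 W1 M.chart_domain[OF U(1)] by blast
  qed (use W0 W1 U sm' in auto)
qed

lemma smooth_map_onI:
  assumes "A \<subseteq> points M" "f ` A \<subseteq> points N"
    and "\<And>p. p \<in> A \<Longrightarrow> \<exists>U \<phi> V \<psi> W. (U, \<phi>) \<in> atlas M \<and> (V, \<psi>) \<in> atlas N \<and>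
        openin (mtop M) W \<and> p \<in> W \<and> W \<subseteq> U \<and> f ` (A \<inter> W) \<subseteq> V \<and>
        smooth_on (\<phi> ` (A \<inter> W)) (\<psi> \<circ> f \<circ> inv_into U \<phi>)"
  shows "smooth_map_on M A N f"
proof -
  have "\<exists>(U, \<phi>) \<in> atlas M. \<exists>(V, \<psi>) \<in> atlas N. \<exists>W.
        openin (mtop M) W \<and> p \<in> W \<and> W \<subseteq> U \<and> f ` (A \<inter> W) \<subseteq> V \<and>
        smooth_on (\<phi> ` (A \<inter> W)) (\<psi> \<circ> f \<circ> inv_into U \<phi>)" if p: "p \<in> A" for p
  proof -
    obtain U \<phi> V \<psi> W where "(U, \<phi>) \<in> atlas M" "(V, \<psi>) \<in> atlas N" and
      "openin (mtop M) W \<and> p \<in> W \<and> W \<subseteq> U \<and> f ` (A \<inter> W) \<subseteq> V \<and>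
        smooth_on (\<phi> ` (A \<inter> W)) (\<psi> \<circ> f \<circ> inv_into U \<phi>)"
      using assms(3)[OF p] by (elim exE conjE) simp
    then show ?thesis
      by (intro bexI[of _ "(U, \<phi>)"] bexI[of _ "(V, \<psi>)"] case_prodI exI[of _ W])
  qed
  then show ?thesis using assms(1,2) unfolding smooth_map_on_def by blast
qed

lemma smooth_map_on_imp_subset: "smooth_map_on M A N f \<Longrightarrow> A \<subseteq> points M"
  and smooth_map_on_imp_image: "smooth_map_on M A N f \<Longrightarrow> f ` A \<subseteq> points N"
  unfolding smooth_map_on_def by auto

lemma smooth_map_on_cong:
  assumes M: "smooth_manifold M"
    and f: "smooth_map_on M A N f" and eq: "\<And>x. x \<in> A \<Longrightarrow> f x = g x"
  shows "smooth_map_on M A N g"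
proof (rule smooth_map_onI)
  show "A \<subseteq> points M" "g ` A \<subseteq> points N"
    using smooth_map_on_imp_subset[OF f] smooth_map_on_imp_image[OF f] eq by auto
  fix p assume p: "p \<in> A"
  obtain U \<phi> V \<psi> W where U: "(U, \<phi>) \<in> atlas M" and V: "(V, \<psi>) \<in> atlas N"
    and W: "openin (mtop M) W" "p \<in> W" "W \<subseteq> U" "f ` (A \<inter> W) \<subseteq> V"
    and sm: "smooth_on (\<phi> ` (A \<inter> W)) (\<psi> \<circ> f \<circ> inv_into U \<phi>)"
    using f p unfolding smooth_map_on_def by (auto; blast)
  have "smooth_on (\<phi> ` (A \<inter> W)) (\<psi> \<circ> g \<circ> inv_into U \<phi>)"
    using sm by (rule smooth_on_cong) (use W(3) eq smooth_manifold.inv_chart[OF M U] in auto)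
  moreover have "g ` (A \<inter> W) \<subseteq> V" using W(4) eq by auto
  ultimately show "\<exists>U \<phi> V \<psi> W. (U, \<phi>) \<in> atlas M \<and> (V, \<psi>) \<in> atlas N \<and>
      openin (mtop M) W \<and> p \<in> W \<and> W \<subseteq> U \<and> g ` (A \<inter> W) \<subseteq> V \<and>
      smooth_on (\<phi> ` (A \<inter> W)) (\<psi> \<circ> g \<circ> inv_into U \<phi>)"
    using U V W by blast
qed

lemma smooth_map_on_compose:
  assumes M: "smooth_manifold M" and N: "smooth_manifold N" and P: "smooth_manifold P"
    and f: "smooth_map_on M A N f" and g: "smooth_map_on N B P g" and sub: "f ` A \<subseteq> B"
  shows "smooth_map_on M A P (\<lambda>x. g (f x))"
proof (rule smooth_map_onI)
  show "A \<subseteq> points M" "(\<lambda>x. g (f x)) ` A \<subseteq> points P"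
    using smooth_map_on_imp_subset[OF f] smooth_map_on_imp_image[OF g] sub by blast+
  fix p assume p: "p \<in> A"
  then have fp: "f p \<in> B" using sub by auto
  obtain U \<phi> where U: "(U, \<phi>) \<in> atlas M" "p \<in> U"
    using smooth_manifold.chart_at[OF M] smooth_map_on_imp_subset[OF f] p by blast
  obtain V \<psi> where V: "(V, \<psi>) \<in> atlas N" "f p \<in> V"
    using smooth_manifold.chart_at[OF N] smooth_map_on_imp_image[OF f] p by blast
  obtain X \<eta> where X: "(X, \<eta>) \<in> atlas P" "g (f p) \<in> X"
    using smooth_manifold.chart_at[OF P] smooth_map_on_imp_image[OF g] fp by blast
  obtain Wf where Wf: "openin (mtop M) Wf" "p \<in> Wf" "Wf \<subseteq> U" "f ` (A \<inter> Wf) \<subseteq> V"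
    "smooth_on (\<phi> ` (A \<inter> Wf)) (\<psi> \<circ> f \<circ> inv_into U \<phi>)"
    using smooth_map_on_in_charts[OF M N f p U V] .
  obtain Wg where Wg: "openin (mtop N) Wg" "f p \<in> Wg" "Wg \<subseteq> V" "g ` (B \<inter> Wg) \<subseteq> X"
    "smooth_on (\<psi> ` (B \<inter> Wg)) (\<eta> \<circ> g \<circ> inv_into V \<psi>)"
    using smooth_map_on_in_charts[OF N P g fp V X] .
  obtain W1 where W1: "openin (mtop M) W1" "p \<in> W1" "f ` (A \<inter> W1) \<subseteq> Wg"
    using smooth_map_on_imp_continuous[OF M N f p Wg(1,2)] .
  let ?W = "Wf \<inter> W1"
  note invU = smooth_manifold.inv_chart[OF M U(1)] and invV = smooth_manifold.inv_chart[OF N V(1)]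
  have "smooth_on (\<phi> ` (A \<inter> ?W)) (\<psi> \<circ> f \<circ> inv_into U \<phi>)"
    using Wf(5) by (rule smooth_on_subset) auto
  then have "smooth_on (\<phi> ` (A \<inter> ?W)) ((\<eta> \<circ> g \<circ> inv_into V \<psi>) \<circ> (\<psi> \<circ> f \<circ> inv_into U \<phi>))"
    by (rule smooth_on_compose[OF _ Wg(5)]) (use Wf(3) W1(3) sub invU in \<open>force simp: subset_eq\<close>)
  then have "smooth_on (\<phi> ` (A \<inter> ?W)) (\<eta> \<circ> (\<lambda>x. g (f x)) \<circ> inv_into U \<phi>)"
  proof (rule smooth_on_cong)
    fix y assume "y \<in> \<phi> ` (A \<inter> ?W)"
    then obtain x where x: "y = \<phi> x" "x \<in> A" "x \<in> Wf" "x \<in> W1" by auto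
    then have "x \<in> U" "f x \<in> V" using Wf by auto
    with x show "((\<eta> \<circ> g \<circ> inv_into V \<psi>) \<circ> (\<psi> \<circ> f \<circ> inv_into U \<phi>)) y
        = (\<eta> \<circ> (\<lambda>x. g (f x)) \<circ> inv_into U \<phi>) y"
      by (simp add: invU invV)
  qed
  moreover have "openin (mtop M) ?W" using Wf W1 by blast
  moreover have "(\<lambda>x. g (f x)) ` (A \<inter> ?W) \<subseteq> X" using W1(3) Wg(4) sub by blast
  moreover have "p \<in> ?W" "?W \<subseteq> U" using Wf W1 by auto
  ultimately show "\<exists>U \<phi> V \<psi> W. (U, \<phi>) \<in> atlas M \<and> (V, \<psi>) \<in> atlas P \<and>
      openin (mtop M) W \<and> p \<in> W \<and> W \<subseteq> U \<and> (\<lambda>x. g (f x)) ` (A \<inter> W) \<subseteq> V \<and>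
      smooth_on (\<phi> ` (A \<inter> W)) (\<psi> \<circ> (\<lambda>x. g (f x)) \<circ> inv_into U \<phi>)"
    using U(1) X(1) by blast
qed

section \<open>Products of manifolds\<close>

lemma prod_manifold_simps [simp]:
  "mtop (prod_manifold M N) = prod_topology (mtop M) (mtop N)"
  "model (prod_manifold M N) = model M \<times> model N"
  by (simp_all add: prod_manifold_def)

lemma prod_atlasI:
  "(U, \<phi>) \<in> atlas M \<Longrightarrow> (V, \<psi>) \<in> atlas N \<Longrightarrow> (U \<times> V, map_prod \<phi> \<psi>) \<in> atlas (prod_manifold M N)"
  by (auto simp: prod_manifold_def)

lemma prod_atlasE:
  assumes "(W, \<eta>) \<in> atlas (prod_manifold M N)"
  obtains U \<phi> V \<psi> where "W = U \<times> V" "\<eta> = map_prod \<phi> \<psi>" "(U, \<phi>) \<in> atlas M" "(V, \<psi>) \<in> atlas N"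
  using assms by (auto simp: prod_manifold_def)

lemma smooth_manifold_prod:
  assumes M: "smooth_manifold M" and N: "smooth_manifold N"
  shows "smooth_manifold (prod_manifold M N)"
proof -
  interpret M: smooth_manifold M by fact
  interpret N: smooth_manifold N by fact
  show ?thesis
  proof
    show "subspace (model (prod_manifold M N))"
      by (simp add: subspace_Times M.subspace_model N.subspace_model)
  next
    fix W \<eta> assume "(W, \<eta>) \<in> atlas (prod_manifold M N)"
    then show "openin (mtop (prod_manifold M N)) W"
      by (elim prod_atlasE) (simp add: openin_prod_Times_iff M.chart_domain N.chart_domain)
  next
    fix W \<eta> assume "(W, \<eta>) \<in> atlas (prod_manifold M N)"
    then show "openin (top_of_set (model (prod_manifold M N))) (\<eta> ` W)"
      by (elim prod_atlasE)
        (simp add: map_prod_surj_on[OF refl refl] openin_Times M.chart_image N.chart_image)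
  next
    fix W \<eta> assume "(W, \<eta>) \<in> atlas (prod_manifold M N)"
    then obtain U \<phi> V \<psi> where *: "W = U \<times> V" "\<eta> = map_prod \<phi> \<psi>"
      and U: "(U, \<phi>) \<in> atlas M" and V: "(V, \<psi>) \<in> atlas N" by (rule prod_atlasE)
    obtain \<phi>' \<psi>' where "homeomorphic_maps (subtopology (mtop M) U) (top_of_set (\<phi> ` U)) \<phi> \<phi>'"
      "homeomorphic_maps (subtopology (mtop N) V) (top_of_set (\<psi> ` V)) \<psi> \<psi>'"
      using M.chart_homeo[OF U] N.chart_homeo[OF V] unfolding homeomorphic_map_maps by blast
    then have "homeomorphic_maps
        (prod_topology (subtopology (mtop M) U) (subtopology (mtop N) V))
        (prod_topology (top_of_set (\<phi> ` U)) (top_of_set (\<psi> ` V)))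
        (\<lambda>(x, y). (\<phi> x, \<psi> y)) (\<lambda>(x, y). (\<phi>' x, \<psi>' y))"
      unfolding homeomorphic_maps_prod by blast
    then have "homeomorphic_map
        (prod_topology (subtopology (mtop M) U) (subtopology (mtop N) V))
        (prod_topology (top_of_set (\<phi> ` U)) (top_of_set (\<psi> ` V))) (map_prod \<phi> \<psi>)"
      unfolding map_prod_def by (rule homeomorphic_maps_imp_map)
    then have "homeomorphic_map (subtopology (prod_topology (mtop M) (mtop N)) (U \<times> V))
        (top_of_set (\<phi> ` U \<times> \<psi> ` V)) (map_prod \<phi> \<psi>)"
      by (simp add: subtopology_Times)
    then show "homeomorphic_map (subtopology (mtop (prod_manifold M N)) W) (top_of_set (\<eta> ` W)) \<eta>"
      by (simp add: * map_prod_surj_on[OF refl refl])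
  next
    fix p assume "p \<in> points (prod_manifold M N)"
    then have p: "fst p \<in> points M" "snd p \<in> points N" by auto
    obtain U \<phi> where U: "(U, \<phi>) \<in> atlas M" "fst p \<in> U" using M.chart_at[OF p(1)] .
    obtain V \<psi> where V: "(V, \<psi>) \<in> atlas N" "snd p \<in> V" using N.chart_at[OF p(2)] .
    show "\<exists>(W, \<eta>)\<in>atlas (prod_manifold M N). p \<in> W"
      by (rule bexI[OF _ prod_atlasI[OF U(1) V(1)]]) (use U(2) V(2) in \<open>simp add: mem_Times_iff\<close>)
  next
    fix W \<eta> W' \<eta>'
    assume W: "(W, \<eta>) \<in> atlas (prod_manifold M N)" and W': "(W', \<eta>') \<in> atlas (prod_manifold M N)"
    from W obtain U \<phi> V \<psi> where *: "W = U \<times> V" "\<eta> = map_prod \<phi> \<psi>"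
      and U: "(U, \<phi>) \<in> atlas M" and V: "(V, \<psi>) \<in> atlas N" by (rule prod_atlasE)
    from W' obtain U' \<phi>' V' \<psi>' where **: "W' = U' \<times> V'" "\<eta>' = map_prod \<phi>' \<psi>'"
      and U': "(U', \<phi>') \<in> atlas M" and V': "(V', \<psi>') \<in> atlas N" by (rule prod_atlasE)
    have im: "\<eta> ` (W \<inter> W') = \<phi> ` (U \<inter> U') \<times> \<psi> ` (V \<inter> V')"
      unfolding * ** Times_Int_Times by (rule map_prod_surj_on) auto
    have "smooth_on (\<phi> ` (U \<inter> U') \<times> \<psi> ` (V \<inter> V'))
        (map_prod (\<phi>' \<circ> inv_into U \<phi>) (\<psi>' \<circ> inv_into V \<psi>))"
      by (intro smooth_on_map_prod M.charts_compatible N.charts_compatible U V U' V')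
    then show "smooth_on (\<eta> ` (W \<inter> W')) (\<eta>' \<circ> inv_into W \<eta>)"
      unfolding im
      by (rule smooth_on_cong)
        (auto simp: * ** inv_into_map_prod[OF M.chart_inj[OF U] N.chart_inj[OF V]])
  qed
qed

lemma smooth_map_fst:
  assumes M: "smooth_manifold M" and N: "smooth_manifold N"
  shows "smooth_map (prod_manifold M N) M fst"
proof (rule smooth_map_onI)
  fix p assume "p \<in> points (prod_manifold M N)"
  then obtain U \<phi> V \<psi> where U: "(U, \<phi>) \<in> atlas M" "fst p \<in> U" and V: "(V, \<psi>) \<in> atlas N" "snd p \<in> V"
    by (metis M N SigmaE fst_conv prod_manifold_simps(1) smooth_manifold.chart_at snd_conv
        topspace_prod_topology)
  let ?W = "U \<times> V" and ?PM = "prod_manifold M N"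
  note PM = smooth_manifold_prod[OF M N]
  have chart: "(?W, map_prod \<phi> \<psi>) \<in> atlas ?PM" using U V by (intro prod_atlasI)
  have "smooth_on (map_prod \<phi> \<psi> ` (points ?PM \<inter> ?W)) (\<phi> \<circ> fst \<circ> inv_into ?W (map_prod \<phi> \<psi>))"
    by (rule smooth_on_cong[OF smooth_on_linear[OF bounded_linear_fst]])
      (auto simp: inv_into_map_prod[OF smooth_manifold.chart_inj[OF M U(1)]
        smooth_manifold.chart_inj[OF N V(1)]] smooth_manifold.inv_chart[OF M U(1)])
  moreover have "openin (mtop ?PM) ?W" using PM chart by (rule smooth_manifold.chart_domain)
  moreover have "p \<in> ?W" using U V by (simp add: mem_Times_iff)
  moreover have "fst ` (points ?PM \<inter> ?W) \<subseteq> U" by auto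
  ultimately show "\<exists>U \<phi> V \<psi> W. (U, \<phi>) \<in> atlas ?PM \<and> (V, \<psi>) \<in> atlas M \<and>
      openin (mtop ?PM) W \<and> p \<in> W \<and> W \<subseteq> U \<and> fst ` (points ?PM \<inter> W) \<subseteq> V \<and>
      smooth_on (\<phi> ` (points ?PM \<inter> W)) (\<psi> \<circ> fst \<circ> inv_into U \<phi>)"
    using chart U(1) by blast
qed auto

lemma smooth_map_snd:
  assumes M: "smooth_manifold M" and N: "smooth_manifold N"
  shows "smooth_map (prod_manifold M N) N snd"
proof (rule smooth_map_onI)
  fix p assume "p \<in> points (prod_manifold M N)"
  then obtain U \<phi> V \<psi> where U: "(U, \<phi>) \<in> atlas M" "fst p \<in> U" and V: "(V, \<psi>) \<in> atlas N" "snd p \<in> V"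
    by (metis M N SigmaE fst_conv prod_manifold_simps(1) smooth_manifold.chart_at snd_conv
        topspace_prod_topology)
  let ?W = "U \<times> V" and ?PM = "prod_manifold M N"
  note PM = smooth_manifold_prod[OF M N]
  have chart: "(?W, map_prod \<phi> \<psi>) \<in> atlas ?PM" using U V by (intro prod_atlasI)
  have "smooth_on (map_prod \<phi> \<psi> ` (points ?PM \<inter> ?W)) (\<psi> \<circ> snd \<circ> inv_into ?W (map_prod \<phi> \<psi>))"
    by (rule smooth_on_cong[OF smooth_on_linear[OF bounded_linear_snd]])
      (auto simp: inv_into_map_prod[OF smooth_manifold.chart_inj[OF M U(1)]
        smooth_manifold.chart_inj[OF N V(1)]] smooth_manifold.inv_chart[OF N V(1)])
  moreover have "openin (mtop ?PM) ?W" using PM chart by (rule smooth_manifold.chart_domain)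
  moreover have "p \<in> ?W" using U V by (simp add: mem_Times_iff)
  moreover have "snd ` (points ?PM \<inter> ?W) \<subseteq> V" by auto
  ultimately show "\<exists>U \<phi> V \<psi> W. (U, \<phi>) \<in> atlas ?PM \<and> (V, \<psi>) \<in> atlas N \<and>
      openin (mtop ?PM) W \<and> p \<in> W \<and> W \<subseteq> U \<and> snd ` (points ?PM \<inter> W) \<subseteq> V \<and>
      smooth_on (\<phi> ` (points ?PM \<inter> W)) (\<psi> \<circ> snd \<circ> inv_into U \<phi>)"
    using chart V(1) by blast
qed auto

lemma smooth_map_on_Pair:
  assumes M: "smooth_manifold M" and N: "smooth_manifold N" and P: "smooth_manifold P"
    and f: "smooth_map_on M A N f" and g: "smooth_map_on M A P g"
  shows "smooth_map_on M A (prod_manifold N P) (\<lambda>x. (f x, g x))"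
proof (rule smooth_map_onI)
  show "A \<subseteq> points M" "(\<lambda>x. (f x, g x)) ` A \<subseteq> points (prod_manifold N P)"
    using smooth_map_on_imp_subset[OF f] smooth_map_on_imp_image[OF f]
      smooth_map_on_imp_image[OF g] by auto
  fix p assume p: "p \<in> A"
  obtain U \<phi> where U: "(U, \<phi>) \<in> atlas M" "p \<in> U"
    using smooth_manifold.chart_at[OF M] smooth_map_on_imp_subset[OF f] p by blast
  obtain V \<psi> where V: "(V, \<psi>) \<in> atlas N" "f p \<in> V"
    using smooth_manifold.chart_at[OF N] smooth_map_on_imp_image[OF f] p by blast
  obtain X \<eta> where X: "(X, \<eta>) \<in> atlas P" "g p \<in> X"
    using smooth_manifold.chart_at[OF P] smooth_map_on_imp_image[OF g] p by blast
  obtain Wf where Wf: "openin (mtop M) Wf" "p \<in> Wf" "Wf \<subseteq> U" "f ` (A \<inter> Wf) \<subseteq> V"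
    "smooth_on (\<phi> ` (A \<inter> Wf)) (\<psi> \<circ> f \<circ> inv_into U \<phi>)"
    using smooth_map_on_in_charts[OF M N f p U V] .
  obtain Wg where Wg: "openin (mtop M) Wg" "p \<in> Wg" "Wg \<subseteq> U" "g ` (A \<inter> Wg) \<subseteq> X"
    "smooth_on (\<phi> ` (A \<inter> Wg)) (\<eta> \<circ> g \<circ> inv_into U \<phi>)"
    using smooth_map_on_in_charts[OF M P g p U X] .
  let ?W = "Wf \<inter> Wg"
  have "smooth_on (\<phi> ` (A \<inter> ?W)) (\<lambda>y. ((\<psi> \<circ> f \<circ> inv_into U \<phi>) y, (\<eta> \<circ> g \<circ> inv_into U \<phi>) y))"
    by (intro smooth_on_Pair smooth_on_subset[OF Wf(5)] smooth_on_subset[OF Wg(5)]) auto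
  then have "smooth_on (\<phi> ` (A \<inter> ?W)) (map_prod \<psi> \<eta> \<circ> (\<lambda>x. (f x, g x)) \<circ> inv_into U \<phi>)"
    by (rule smooth_on_cong) auto
  moreover have "openin (mtop M) ?W" using Wf Wg by blast
  moreover have "(\<lambda>x. (f x, g x)) ` (A \<inter> ?W) \<subseteq> V \<times> X" using Wf(4) Wg(4) by auto
  moreover have "p \<in> ?W" "?W \<subseteq> U" using Wf Wg by auto
  moreover have "(V \<times> X, map_prod \<psi> \<eta>) \<in> atlas (prod_manifold N P)"
    using V X by (intro prod_atlasI)
  ultimately show "\<exists>U \<phi> V \<psi> W. (U, \<phi>) \<in> atlas M \<and> (V, \<psi>) \<in> atlas (prod_manifold N P) \<and>
      openin (mtop M) W \<and> p \<in> W \<and> W \<subseteq> U \<and> (\<lambda>x. (f x, g x)) ` (A \<inter> W) \<subseteq> V \<and>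
      smooth_on (\<phi> ` (A \<inter> W)) (\<psi> \<circ> (\<lambda>x. (f x, g x)) \<circ> inv_into U \<phi>)"
    using U(1) by blast
qed

lemma smooth_map_on_fst:
  assumes "smooth_manifold M" "smooth_manifold N" "smooth_manifold P"
    and "smooth_map_on P A (prod_manifold M N) f"
  shows "smooth_map_on P A M (\<lambda>x. fst (f x))"
  using assms by (intro smooth_map_on_compose[OF _ _ _ assms(4) smooth_map_fst]
      smooth_manifold_prod smooth_map_on_imp_image)

lemma smooth_map_on_snd:
  assumes "smooth_manifold M" "smooth_manifold N" "smooth_manifold P"
    and "smooth_map_on P A (prod_manifold M N) f"
  shows "smooth_map_on P A N (\<lambda>x. snd (f x))"
  using assms by (intro smooth_map_on_compose[OF _ _ _ assms(4) smooth_map_snd]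
      smooth_manifold_prod smooth_map_on_imp_image)

lemma smooth_map_on_id:
  assumes M: "smooth_manifold M" and A: "A \<subseteq> points M"
  shows "smooth_map_on M A M (\<lambda>x. x)"
proof (rule smooth_map_onI)
  fix p assume "p \<in> A"
  then obtain U \<phi> where U: "(U, \<phi>) \<in> atlas M" "p \<in> U"
    using smooth_manifold.chart_at[OF M] A by blast
  have "smooth_on (\<phi> ` (A \<inter> U)) (\<phi> \<circ> (\<lambda>x. x) \<circ> inv_into U \<phi>)"
    by (rule smooth_on_cong[OF smooth_on_linear[OF bounded_linear_ident]])
      (auto simp: smooth_manifold.inv_chart[OF M U(1)])
  then show "\<exists>U \<phi> V \<psi> W. (U, \<phi>) \<in> atlas M \<and> (V, \<psi>) \<in> atlas M \<and>
      openin (mtop M) W \<and> p \<in> W \<and> W \<subseteq> U \<and> (\<lambda>x. x) ` (A \<inter> W) \<subseteq> V \<and>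
      smooth_on (\<phi> ` (A \<inter> W)) (\<psi> \<circ> (\<lambda>x. x) \<circ> inv_into U \<phi>)"
    using U smooth_manifold.chart_domain[OF M U(1)] by blast
qed (use A in auto)

lemma smooth_map_on_map_prod:
  assumes M: "smooth_manifold M" and N: "smooth_manifold N"
    and M': "smooth_manifold M'" and N': "smooth_manifold N'"
    and f: "smooth_map M N f" and g: "smooth_map M' N' g"
  shows "smooth_map (prod_manifold M M') (prod_manifold N N') (map_prod f g)"
proof -
  let ?P = "prod_manifold M M'"
  have "smooth_map ?P (prod_manifold N N') (\<lambda>x. (f (fst x), g (snd x)))"
    by (intro smooth_map_on_Pair smooth_map_on_compose[OF _ M N smooth_map_fst f]
        smooth_map_on_compose[OF _ M' N' smooth_map_snd g] smooth_manifold_prod M M' N N') auto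
  then show ?thesis
    by (rule smooth_map_on_cong[OF smooth_manifold_prod[OF M M']]) auto
qed

text \<open>In product charts the representative of \<open>map_prod f g\<close> is the product of the two
  representatives, and its derivative, the product of the derivatives, maps the product of
  the model spaces onto the product of their images.\<close>

lemma submersion_map_prod:
  assumes M: "smooth_manifold M" and N: "smooth_manifold N"
    and M': "smooth_manifold M'" and N': "smooth_manifold N'"
    and f: "submersion M N f" and g: "submersion M' N' g"
  shows "submersion (prod_manifold M M') (prod_manifold N N') (map_prod f g)"
proof -
  have surj: "\<exists>D. (\<psi> \<circ> map_prod f g \<circ> inv_into U \<phi> has_derivative D) (at (\<phi> p) within \<phi> ` U) \<and>
          D ` model (prod_manifold M M') = model (prod_manifold N N')"
    if U: "(U, \<phi>) \<in> atlas (prod_manifold M M')" and V: "(V, \<psi>) \<in> atlas (prod_manifold N N')"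
      and p: "p \<in> U" "map_prod f g p \<in> V" for U \<phi> V \<psi> p
  proof -
    obtain U1 \<phi>1 U2 \<phi>2 where U: "U = U1 \<times> U2" "\<phi> = map_prod \<phi>1 \<phi>2"
      and U1: "(U1, \<phi>1) \<in> atlas M" and U2: "(U2, \<phi>2) \<in> atlas M'" using U by (rule prod_atlasE)
    obtain V1 \<psi>1 V2 \<psi>2 where V: "V = V1 \<times> V2" "\<psi> = map_prod \<psi>1 \<psi>2"
      and V1: "(V1, \<psi>1) \<in> atlas N" and V2: "(V2, \<psi>2) \<in> atlas N'" using V by (rule prod_atlasE)
    obtain p1 p2 where pp: "p = (p1, p2)" by (cases p)
    have p1: "p1 \<in> U1" "f p1 \<in> V1" and p2: "p2 \<in> U2" "g p2 \<in> V2"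
      using p by (auto simp: U V pp)
    let ?f = "\<psi>1 \<circ> f \<circ> inv_into U1 \<phi>1" and ?g = "\<psi>2 \<circ> g \<circ> inv_into U2 \<phi>2"
    obtain D1 where D1: "(?f has_derivative D1) (at (\<phi>1 p1) within \<phi>1 ` U1)"
      "D1 ` model M = model N"
      using f U1 V1 p1 unfolding submersion_def by fast
    obtain D2 where D2: "(?g has_derivative D2) (at (\<phi>2 p2) within \<phi>2 ` U2)"
      "D2 ` model M' = model N'"
      using g U2 V2 p2 unfolding submersion_def by fast
    let ?S = "\<phi>1 ` U1 \<times> \<phi>2 ` U2" and ?x = "(\<phi>1 p1, \<phi>2 p2)"
    have f': "(?f has_derivative D1) (at (fst ?x) within fst ` ?S)"
      unfolding fst_conv by (rule has_derivative_subset[OF D1(1)]) auto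
    have g': "(?g has_derivative D2) (at (snd ?x) within snd ` ?S)"
      unfolding snd_conv by (rule has_derivative_subset[OF D2(1)]) auto
    have 1: "((\<lambda>y. ?f (fst y)) has_derivative (\<lambda>v. D1 (fst v))) (at ?x within ?S)"
      by (rule has_derivative_in_compose[OF _ f'])
        (rule bounded_linear_imp_has_derivative[OF bounded_linear_fst])
    have 2: "((\<lambda>y. ?g (snd y)) has_derivative (\<lambda>v. D2 (snd v))) (at ?x within ?S)"
      by (rule has_derivative_in_compose[OF _ g'])
        (rule bounded_linear_imp_has_derivative[OF bounded_linear_snd])
    have "((\<lambda>y. (?f (fst y), ?g (snd y))) has_derivative (\<lambda>v. (D1 (fst v), D2 (snd v))))
        (at ?x within ?S)"
      by (rule has_derivative_Pair[OF 1 2])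
    then have "(\<psi> \<circ> map_prod f g \<circ> inv_into U \<phi> has_derivative (\<lambda>v. (D1 (fst v), D2 (snd v))))
        (at ?x within ?S)"
      by (rule has_derivative_transform[rotated 2])
        (use p1 p2 in \<open>auto simp: U V inv_into_map_prod[OF smooth_manifold.chart_inj[OF M U1]
          smooth_manifold.chart_inj[OF M' U2]]\<close>)
    moreover have "\<phi> p = ?x" "\<phi> ` U = ?S"
      by (simp_all add: U pp map_prod_surj_on[OF refl refl])
    moreover have "(\<lambda>v. (D1 (fst v), D2 (snd v))) ` (model M \<times> model M') = model N \<times> model N'"
      using map_prod_surj_on[OF D1(2) D2(2)] by (simp add: map_prod_def case_prod_beta')
    ultimately show ?thesis by auto
  qed
  have "smooth_map (prod_manifold M M') (prod_manifold N N') (map_prod f g)"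
    using f g smooth_map_on_map_prod[OF M N M' N'] by (simp add: submersion_def)
  then show ?thesis
    unfolding submersion_def by (intro conjI ballI) (assumption, clarify, erule (3) surj)
qed

section \<open>The product of two Lie groupoids\<close>

lemma prod_groupoid_simps [simp]:
  "arrow_mfd (prod_groupoid G H) = prod_manifold (arrow_mfd G) (arrow_mfd H)"
  "object_mfd (prod_groupoid G H) = prod_manifold (object_mfd G) (object_mfd H)"
  "src (prod_groupoid G H) = map_prod (src G) (src H)"
  "tgt (prod_groupoid G H) = map_prod (tgt G) (tgt H)"
  "unit_at (prod_groupoid G H) = map_prod (unit_at G) (unit_at H)"
  "ginv (prod_groupoid G H) = map_prod (ginv G) (ginv H)"
  "mult (prod_groupoid G H) (g, h) (g', h') = (mult G g g', mult H h h')"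
  by (simp_all add: prod_groupoid_def)

lemma composable_iff:
  "(g, h) \<in> composable G \<longleftrightarrow> g \<in> arrows G \<and> h \<in> arrows G \<and> src G g = tgt G h"
  by (simp add: composable_def)

lemma composable_prod_groupoid:
  "((g, h), (g', h')) \<in> composable (prod_groupoid G H) \<longleftrightarrow>
    (g, g') \<in> composable G \<and> (h, h') \<in> composable H"
  by (auto simp: composable_iff)

lemma groupoid_prod:
  assumes "groupoid G" "groupoid H"
  shows "groupoid (prod_groupoid G H)"
proof -
  interpret G: groupoid G by fact
  interpret H: groupoid H by fact
  show ?thesis
  proof
    show "src (prod_groupoid G H) ` arrows (prod_groupoid G H) = objects (prod_groupoid G H)"
      by (simp add: map_prod_surj_on[OF G.src_surj H.src_surj])
    show "tgt (prod_groupoid G H) ` arrows (prod_groupoid G H) = objects (prod_groupoid G H)"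
      by (simp add: map_prod_surj_on[OF G.tgt_surj H.tgt_surj])
  qed (auto simp: composable_prod_groupoid G.unit_closed H.unit_closed G.ginv_closed H.ginv_closed
      G.mult_closed H.mult_closed G.src_mult H.src_mult G.tgt_mult H.tgt_mult G.mult_assoc
      H.mult_assoc G.src_unit H.src_unit G.tgt_unit H.tgt_unit G.unit_left H.unit_left
      G.unit_right H.unit_right G.src_ginv H.src_ginv G.tgt_ginv H.tgt_ginv G.ginv_left
      H.ginv_left G.ginv_right H.ginv_right)
qed

lemma (in lie_groupoid) smooth_mult_maps:
  assumes P: "smooth_manifold P"
    and f: "smooth_map_on P A (arrow_mfd G) f" and g: "smooth_map_on P A (arrow_mfd G) g"
    and "\<And>x. x \<in> A \<Longrightarrow> (f x, g x) \<in> composable G"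
  shows "smooth_map_on P A (arrow_mfd G) (\<lambda>x. mult G (f x) (g x))"
proof -
  note M = manifold_arrows
  have "smooth_map_on P A (arrow_mfd G) (\<lambda>x. case (f x, g x) of (a, b) \<Rightarrow> mult G a b)"
    by (rule smooth_map_on_compose[OF P smooth_manifold_prod[OF M M] M
          smooth_map_on_Pair[OF P M M f g] smooth_mult]) (use assms(4) in auto)
  then show ?thesis by simp
qed

lemma lie_groupoid_prod:
  assumes "lie_groupoid G" "lie_groupoid H"
  shows "lie_groupoid (prod_groupoid G H)"
proof -
  interpret G: lie_groupoid G by fact
  interpret H: lie_groupoid H by fact
  interpret P: groupoid "prod_groupoid G H"
    by (intro groupoid_prod G.groupoid_axioms H.groupoid_axioms)
  let ?P = "prod_groupoid G H"
  note mfds = G.manifold_objects H.manifold_objects G.manifold_arrows H.manifold_arrows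
  show ?thesis
  proof (intro lie_groupoid.intro lie_groupoid_axioms.intro)
    show "groupoid ?P" by (rule P.groupoid_axioms)
    show "smooth_manifold (object_mfd ?P)" "smooth_manifold (arrow_mfd ?P)"
      by (simp_all add: smooth_manifold_prod mfds)
    show "Hausdorff_space (mtop (object_mfd ?P))"
      by (simp add: Hausdorff_space_prod_topology G.Hausdorff_objects H.Hausdorff_objects)
    show "submersion (arrow_mfd ?P) (object_mfd ?P) (src ?P)"
      by (simp add: submersion_map_prod mfds G.submersion_src H.submersion_src)
    show "smooth_map (arrow_mfd ?P) (object_mfd ?P) (tgt ?P)"
      using smooth_map_on_map_prod[OF mfds(3,1,4,2) G.smooth_tgt H.smooth_tgt] by simp
    show "smooth_map (object_mfd ?P) (arrow_mfd ?P) (unit_at ?P)"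
      using smooth_map_on_map_prod[OF mfds(1,3,2,4) G.smooth_unit H.smooth_unit] by simp
    show "smooth_map (arrow_mfd ?P) (arrow_mfd ?P) (ginv ?P)"
      using smooth_map_on_map_prod[OF mfds(3,3,4,4) G.smooth_ginv H.smooth_ginv] by simp
  next
    fix x assume x: "x \<in> objects ?P"
    obtain a b where ab: "x = (a, b)" by (cases x)
    have "{g \<in> arrows ?P. src ?P g = x} =
        {g \<in> arrows G. src G g = a} \<times> {h \<in> arrows H. src H h = b}"
      by (auto simp: ab)
    moreover have "a \<in> objects G" "b \<in> objects H" using x by (auto simp: ab)
    ultimately show "Hausdorff_space (subtopology (mtop (arrow_mfd ?P)) {g \<in> arrows ?P. src ?P g = x})"
      by (simp add: subtopology_Times Hausdorff_space_prod_topology G.Hausdorff_src_fibres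
          H.Hausdorff_src_fibres)
  next
    let ?M = "arrow_mfd ?P" and ?C = "composable ?P"
    have M: "smooth_manifold ?M" by (simp add: smooth_manifold_prod mfds)
    have MM: "smooth_manifold (prod_manifold ?M ?M)" by (intro smooth_manifold_prod M)
    have id: "smooth_map_on (prod_manifold ?M ?M) ?C (prod_manifold ?M ?M) (\<lambda>x. x)"
      using MM by (rule smooth_map_on_id) (auto simp: composable_def)
    \<comment> \<open>\<open>l\<close> and \<open>r\<close> pick the two arrows of the product groupoid; projecting each of them once more
      gives the four arrows that the multiplications of the factors are applied to.\<close>
    note l = smooth_map_on_fst[OF M M MM id, unfolded prod_groupoid_simps(1)]
    note r = smooth_map_on_snd[OF M M MM id, unfolded prod_groupoid_simps(1)]
    note MM' = MM[unfolded prod_groupoid_simps(1)]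
    have "smooth_map_on (prod_manifold ?M ?M) ?C ?M
        (\<lambda>x. (mult G (fst (fst x)) (fst (snd x)), mult H (snd (fst x)) (snd (snd x))))"
      unfolding prod_groupoid_simps(1)
      by (intro smooth_map_on_Pair G.smooth_mult_maps H.smooth_mult_maps MM' mfds
          smooth_map_on_fst[OF mfds(3,4) MM' l] smooth_map_on_fst[OF mfds(3,4) MM' r]
          smooth_map_on_snd[OF mfds(3,4) MM' l] smooth_map_on_snd[OF mfds(3,4) MM' r])
        (auto simp: composable_prod_groupoid)
    then show "smooth_map_on (prod_manifold ?M ?M) ?C ?M (\<lambda>(g, h). mult ?P g h)"
      by (rule smooth_map_on_cong[OF MM]) auto
  qed
qed

section \<open>Conjugation\<close>

context groupoid
begin

lemma ginv_unique:
  assumes "(g, h) \<in> composable G" "mult G g h = unit_at G (tgt G g)"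
  shows "h = ginv G g"
proof -
  have g: "g \<in> arrows G" and h: "h \<in> arrows G" and gh: "src G g = tgt G h"
    using assms(1) by (auto simp: composable_iff)
  have "h = mult G (mult G (ginv G g) g) h"
    using g h gh by (simp add: ginv_left unit_left)
  also have "\<dots> = mult G (ginv G g) (mult G g h)"
    using assms(1) g by (intro mult_assoc) (auto simp: composable_iff ginv_closed src_ginv)
  also have "\<dots> = ginv G g"
    using assms(2) g unit_right[OF ginv_closed[OF g]] by (simp add: src_ginv)
  finally show ?thesis .
qed

lemma ginv_mult:
  assumes "(g, h) \<in> composable G"
  shows "ginv G (mult G g h) = mult G (ginv G h) (ginv G g)"
proof -
  have g: "g \<in> arrows G" and h: "h \<in> arrows G" and gh: "src G g = tgt G h"
    using assms by (auto simp: composable_iff)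
  note facts = g h gh composable_iff ginv_closed src_ginv tgt_ginv mult_closed src_mult tgt_mult
  have "mult G (mult G g h) (mult G (ginv G h) (ginv G g))
      = mult G g (mult G h (mult G (ginv G h) (ginv G g)))"
    by (rule mult_assoc) (simp_all add: facts)
  also have "mult G h (mult G (ginv G h) (ginv G g)) = mult G (mult G h (ginv G h)) (ginv G g)"
    by (rule mult_assoc[symmetric]) (simp_all add: facts)
  also have "\<dots> = ginv G g"
    using unit_left[OF ginv_closed[OF g]] by (simp add: facts ginv_right)
  also have "mult G g (ginv G g) = unit_at G (tgt G g)"
    using g by (rule ginv_right)
  finally show ?thesis
    by (intro ginv_unique[symmetric]) (simp_all add: facts)
qed

lemma conj_assoc:
  assumes "(h1, g1) \<in> composable G" "(h2, g2) \<in> composable G" "n \<in> arrows G"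
    and "src G g1 = tgt G n" "src G g2 = src G n"
  shows "mult G (mult G h1 (mult G (mult G g1 n) (ginv G g2))) (ginv G h2)
       = mult G (mult G (mult G h1 g1) n) (ginv G (mult G h2 g2))"
proof -
  have "h1 \<in> arrows G" "g1 \<in> arrows G" "src G h1 = tgt G g1"
    "h2 \<in> arrows G" "g2 \<in> arrows G" "src G h2 = tgt G g2"
    using assms by (auto simp: composable_iff)
  note facts = this assms(3-5) composable_iff ginv_closed src_ginv tgt_ginv mult_closed
    src_mult tgt_mult
  show ?thesis
    by (simp add: facts mult_assoc ginv_mult)
qed

end

lemma fibre_prod_conj_momentum:
  "fibre_prod (prod_groupoid G G) (conj_momentum G) (arrow_mfd G) = conj_domain G"
  by (auto simp: fibre_prod_def conj_domain_def conj_momentum_def)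

lemma (in lie_groupoid) smooth_conj_map:
  "smooth_map_on (prod_manifold (prod_manifold (arrow_mfd G) (arrow_mfd G)) (arrow_mfd G))
     (conj_domain G) (arrow_mfd G) (conj_map G)"
proof -
  note M = manifold_arrows
  let ?M = "arrow_mfd G"
  let ?P = "prod_manifold (prod_manifold ?M ?M) ?M"
  have MM: "smooth_manifold (prod_manifold ?M ?M)" by (intro smooth_manifold_prod M)
  have P: "smooth_manifold ?P" by (intro smooth_manifold_prod M MM)
  have id: "smooth_map_on ?P (conj_domain G) ?P (\<lambda>x. x)"
    using P by (rule smooth_map_on_id) (auto simp: conj_domain_def)
  note g12 = smooth_map_on_fst[OF MM M P id]
  note g1 = smooth_map_on_fst[OF M M P g12] and g2 = smooth_map_on_snd[OF M M P g12]
    and g3 = smooth_map_on_snd[OF MM M P id]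
  have inv: "smooth_map_on ?P (conj_domain G) ?M (\<lambda>x. ginv G (snd (fst x)))"
    by (rule smooth_map_on_compose[OF P M M g2 smooth_ginv]) (auto simp: conj_domain_def)
  have "smooth_map_on ?P (conj_domain G) ?M
      (\<lambda>x. mult G (mult G (fst (fst x)) (snd x)) (ginv G (snd (fst x))))"
    by (intro smooth_mult_maps P g1 g3 inv)
      (auto simp: conj_domain_def composable_iff mult_closed src_mult ginv_closed tgt_ginv)
  then show ?thesis
    by (rule smooth_map_on_cong[OF P]) (auto simp: conj_map_def)
qed

theorem proposition3p5:
  fixes G :: "('g, 'x, 'e::euclidean_space, 'f::euclidean_space) groupoid_data"
  assumes "lie_groupoid G"
  shows "left_action (prod_groupoid G G) (arrow_mfd G) (conj_momentum G) (conj_map G)"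
proof -
  interpret lie_groupoid G by fact
  interpret P: lie_groupoid "prod_groupoid G G" by (intro lie_groupoid_prod assms)
  note closure = composable_iff ginv_closed src_ginv tgt_ginv mult_closed src_mult tgt_mult
  show ?thesis
  proof (intro left_action.intro left_action_axioms.intro)
    show "lie_groupoid (prod_groupoid G G)" by (rule P.lie_groupoid_axioms)
    show "smooth_manifold (arrow_mfd G)" by (rule manifold_arrows)
    have "smooth_map (arrow_mfd G) (object_mfd G) (src G)"
      using submersion_src by (simp add: submersion_def)
    then have "smooth_map (arrow_mfd G) (object_mfd (prod_groupoid G G)) (\<lambda>g. (tgt G g, src G g))"
      by (simp add: smooth_map_on_Pair manifold_arrows manifold_objects smooth_tgt)
    then show "smooth_map (arrow_mfd G) (object_mfd (prod_groupoid G G)) (conj_momentum G)"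
      by (simp add: conj_momentum_def[abs_def])
    show "smooth_map_on (prod_manifold (arrow_mfd (prod_groupoid G G)) (arrow_mfd G))
        (fibre_prod (prod_groupoid G G) (conj_momentum G) (arrow_mfd G)) (arrow_mfd G) (conj_map G)"
      using smooth_conj_map by (simp add: fibre_prod_conj_momentum)
  next
    fix k n assume "(k, n) \<in> fibre_prod (prod_groupoid G G) (conj_momentum G) (arrow_mfd G)"
    then show "conj_momentum G (conj_map G (k, n)) = tgt (prod_groupoid G G) k"
      unfolding fibre_prod_conj_momentum
      by (cases k) (auto simp: conj_map_def conj_domain_def conj_momentum_def closure)
  next
    fix k1 k2 n
    assume k: "(k1, k2) \<in> composable (prod_groupoid G G)"
      and n: "(k2, n) \<in> fibre_prod (prod_groupoid G G) (conj_momentum G) (arrow_mfd G)"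
    obtain h1 h2 g1 g2 where [simp]: "k1 = (h1, h2)" "k2 = (g1, g2)" by (cases k1, cases k2)
    have k': "(h1, g1) \<in> composable G" "(h2, g2) \<in> composable G"
      using k by (auto simp: composable_prod_groupoid)
    have n': "((g1, g2), n) \<in> conj_domain G"
      using n by (simp add: fibre_prod_conj_momentum)
    then have n'': "n \<in> arrows G" "src G g1 = tgt G n" "src G g2 = src G n"
      by (auto simp: conj_domain_def)
    have "((h1, h2), mult G (mult G g1 n) (ginv G g2)) \<in> conj_domain G"
      "((mult G h1 g1, mult G h2 g2), n) \<in> conj_domain G"
      using k' n'' by (auto simp: conj_domain_def closure)
    with n' show "conj_map G (k1, conj_map G (k2, n)) = conj_map G (mult (prod_groupoid G G) k1 k2, n)"
      using conj_assoc[OF k' n''] by (simp add: conj_map_def)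
  next
    fix n assume n: "n \<in> arrows G"
    have t: "tgt G n \<in> objects G" and s: "src G n \<in> objects G"
      using n src_surj tgt_surj by auto
    \<comment> \<open>A unit is its own inverse, so conjugation by a pair of units only multiplies by units.\<close>
    have "mult G (unit_at G (src G n)) (unit_at G (src G n)) = unit_at G (src G n)"
      using unit_left[OF unit_closed[OF s]] s by (simp add: tgt_unit)
    then have "ginv G (unit_at G (src G n)) = unit_at G (src G n)"
      using s by (intro ginv_unique[symmetric]) (auto simp: composable_iff unit_closed src_unit tgt_unit)
    then show "conj_map G (unit_at (prod_groupoid G G) (conj_momentum G n), n) = n"
      using n s t by (simp add: conj_map_def conj_domain_def conj_momentum_def unit_closed src_unit
          unit_left unit_right)
  qed
qed

end
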